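(* Let $n,m$ be positive integers and $0<\varepsilon<1/4$. Let $G$ be an abelian group, $Y\subseteq G$ with $|Y|=n$, and $\beta=\beta_G((1+4\varepsilon)m)$. There exists a collection $\mathcal{C}\subseteq 2^{Y+Y}\times2^Y\times2^Y$ with $|\mathcal{C}|\le n^{2^7\varepsilon^{-2}\sqrt m}$ such that the following holds. For every pair $(A,B)$ of subsets of $Y$ with $|A|\ge\sqrt m$, $|B|\ge(1+\varepsilon^{-2})\sqrt m$ and $|A+B|\le m$, there exists $(C_0,C_1,C_2)\in\mathcal{C}$ such that (1) $(Y+Y)\setminus(A+B)\subseteq C_0$, $A\subseteq C_1$ and $B\subseteq C_2$; (2) $|C_1|+|C_2|\le(1+2\varepsilon)(m+\beta)$. Additionally, every $(C_0,C_1,C_2)\in\mathcal{C}$ satisfies $|C_1|,|C_2|\le m/4$ or $e(\mathcal{H}(C_0,C_1,C_2))<\varepsilon^2|C_1||C_2|$.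
   Context: For an abelian group $G$ and real $x>0$, $\beta_G(x)$ denotes the largest size of a subgroup $H\le G$ with $|H|\le x$. For $U_0\subseteq Y+Y$ and $U_1,U_2\subseteq Y$, $\mathcal{H}(U_0,U_1,U_2)$ is the tripartite $3$-uniform hypergraph with parts $U_0,U_1,U_2$ (treated as disjoint copies) in which $a\in U_1$, $b\in U_2$, $c\in U_0$ form an edge iff $c=a+b$; $e(\cdot)$ is its number of edges. Logarithms are base $2$. *)

theory Defs
  imports Complex_Main "HOL-Library.Set_Algebras"
begin

definition add_subgroup :: "'a::ab_group_add set \<Rightarrow> bool" where
  "add_subgroup H \<longleftrightarrow> 0 \<in> H \<and> (\<forall>x\<in>H. \<forall>y\<in>H. x + y \<in> H) \<and> (\<forall>x\<in>H. - x \<in> H)"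

text \<open>
  The ambient group \<open>G\<close> is the type \<^typ>\<open>'a\<close>. Only finite subgroups compete
  (\<^const>\<open>card\<close> of an infinite set is \<open>0\<close>, hence the explicit \<^const>\<open>finite\<close>). The
  maximum is over a finite set of naturals, which is nonempty for \<open>x \<ge> 1\<close> because of the
  trivial subgroup; for \<open>x < 1\<close> there is no such subgroup and the value is irrelevant.
\<close>

definition beta :: "'a::ab_group_add itself \<Rightarrow> real \<Rightarrow> nat" where
  "beta G x = Max {card H | H :: 'a set. add_subgroup H \<and> finite H \<and> real (card H) \<le> x}"

text \<open>
  Edges of a tripartite hypergraph on disjoint copies of \<open>U0\<close>, \<open>U1\<close>, \<open>U2\<close> are encoded as
  ordered triples; the position in the triple records the part a vertex belongs to.
\<close>

definition sum_hyperedges ::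
    "'a::ab_group_add set \<Rightarrow> 'a set \<Rightarrow> 'a set \<Rightarrow> ('a \<times> 'a \<times> 'a) set" where
  "sum_hyperedges U0 U1 U2 = {(c, a, b). c \<in> U0 \<and> a \<in> U1 \<and> b \<in> U2 \<and> c = a + b}"

end

theory Submission
  imports Defs
begin

text \<open>
  A container is read off a fingerprint \<open>X \<subseteq> A\<close>, \<open>Z \<subseteq> B\<close>: with \<open>D = X + Z \<subseteq> A + B\<close>, the part \<open>C0\<close> is
  the complement of \<open>D\<close>, and \<open>C1\<close>, \<open>C2\<close> contain only elements whose sums with \<open>Z\<close>, respectively \<open>X\<close>,
  lie almost entirely in \<open>D\<close>. Adding to the fingerprint an element of \<open>A\<close> or \<open>B\<close> that violates this
  enlarges \<open>D\<close> by at least \<open>\<tau>\<close>, which happens at most \<open>m / \<tau>\<close> times. If many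
  pairs of \<open>C1 \<times> C2\<close> still have sums outside \<open>D\<close>, then either \<open>A\<close> has \<open>s\<close> elements of high degree,
  and adding these makes \<open>|C1| + |C2| - |D|\<close> drop by a constant multiple of \<open>\<epsilon>\<^sup>2 m\<close>, or it has fewer, and then all
  other elements of high degree can be discarded from \<open>C1\<close>, which ends the process. As
  \<open>|C1|, |C2| = O(m)\<close> after the first saturation, there are \<open>O(\<epsilon>\<^sup>-\<^sup>2)\<close> rounds, each costing \<open>s \<approx> \<surd>m\<close> elements.

  The size bound follows from Pollard's theorem for abelian groups, which is proved by Dyson
  transforms: they get stuck only if \<open>B\<close> lies in a coset of the stabilizer of \<open>A\<close>, and that is where
  \<open>\<beta>\<close> enters.
\<close>

section \<open>Pollard's theorem\<close>

definition deg :: "'a::ab_group_add set \<Rightarrow> 'a set \<Rightarrow> 'a \<Rightarrow> nat" where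
  "deg D S x = card {y \<in> S. x + y \<notin> D}"

text \<open>The edge count of the theorem: with \<open>U\<close>, \<open>V\<close> inside
  \<open>Y\<close> and \<open>C0\<close> the complement of \<open>D\<close> in \<open>Y + Y\<close>,
  an edge is determined by its pair of summands.\<close>

definition off :: "'a::ab_group_add set \<Rightarrow> 'a set \<Rightarrow> 'a set \<Rightarrow> nat" where
  "off D U V = card {p \<in> U \<times> V. fst p + snd p \<notin> D}"

lemma off_eq_sum_deg:
  assumes "finite U" "finite V"
  shows "off D U V = (\<Sum>a\<in>U. deg D V a)"
proof -
  have "{p \<in> U \<times> V. fst p + snd p \<notin> D} = Sigma U (\<lambda>a. {y \<in> V. a + y \<notin> D})"
    by auto
  then show ?thesis
    using assms by (simp add: off_def deg_def)
qed

lemma off_commute: "off D U V = off D V U"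
proof -
  have "bij_betw prod.swap {p \<in> U \<times> V. fst p + snd p \<notin> D} {p \<in> V \<times> U. fst p + snd p \<notin> D}"
    by (rule bij_betw_byWitness[where f' = prod.swap]) (auto simp: add.commute)
  then show ?thesis
    unfolding off_def by (rule bij_betw_same_card)
qed

lemma off_Un_left:
  assumes "finite U" "finite U'" "finite V" "U \<inter> U' = {}"
  shows "off D (U \<union> U') V = off D U V + off D U' V"
  using assms by (simp add: off_eq_sum_deg sum.union_disjoint)

lemma off_Un_right:
  assumes "finite U" "finite V" "finite V'" "V \<inter> V' = {}"
  shows "off D U (V \<union> V') = off D U V + off D U V'"
  using off_Un_left[OF assms(2,3,1,4)] by (simp add: off_commute)

lemma off_translate: "off ((+) e ` D) U ((+) e ` V) = off D U V"
proof -
  have "bij_betw (\<lambda>(a, b). (a, e + b)) {p \<in> U \<times> V. fst p + snd p \<notin> D}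
      {p \<in> U \<times> (+) e ` V. fst p + snd p \<notin> (+) e ` D}"
    by (rule bij_betw_byWitness[where f' = "\<lambda>(a, b). (a, b - e)"]) (auto simp: algebra_simps image_iff)
  then show ?thesis
    unfolding off_def by (rule bij_betw_same_card[symmetric])
qed

lemma deg_le_card: "finite S \<Longrightarrow> deg D S x \<le> card S"
  unfolding deg_def by (intro card_mono) auto

text \<open>Translation by \<open>x\<close> is injective, so it sends at most \<open>card D\<close>
  elements of \<open>S\<close> into \<open>D\<close>.\<close>

lemma card_le_card_plus_deg:
  assumes "finite S" "finite D"
  shows "card S \<le> card D + deg D S x"
proof -
  have "card {y \<in> S. x + y \<in> D} \<le> card D"
    by (intro card_inj_on_le[where f = "(+) x"]) (use assms in auto)
  moreover have "card S = card {y \<in> S. x + y \<in> D} + deg D S x"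
    unfolding deg_def using assms(1)
    by (subst card_Un_disjoint[symmetric]) (auto intro!: arg_cong[where f = card])
  ultimately show ?thesis by simp
qed

lemma card_times_le_off:
  assumes "finite U" "finite V" "finite D"
  shows "card U * card V \<le> card U * card D + off D U V"
proof -
  have "card U * card V = (\<Sum>a\<in>U. card V)" by simp
  also have "\<dots> \<le> (\<Sum>a\<in>U. card D + deg D V a)"
    by (intro sum_mono card_le_card_plus_deg assms)
  finally show ?thesis
    using assms by (simp add: off_eq_sum_deg sum.distrib)
qed

text \<open>A translation mapping the finite set \<open>A\<close> into itself is injective, hence
  permutes \<open>A\<close>; surjectivity supplies the inverses.\<close>

lemma add_subgroup_stabilizer:
  fixes A :: "'a::ab_group_add set"
  assumes "finite A"
  shows "add_subgroup {h. \<forall>a\<in>A. a + h \<in> A}"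
proof -
  have inv: "a + (- h) \<in> A" if h: "\<forall>a\<in>A. a + h \<in> A" and a: "a \<in> A" for h a
  proof -
    have "(\<lambda>a. a + h) ` A = A"
      by (rule endo_inj_surj) (use assms h in \<open>auto simp: inj_on_def\<close>)
    then obtain c where "c \<in> A" "a = c + h" using a by auto
    then show ?thesis by simp
  qed
  show ?thesis
    unfolding add_subgroup_def using inv by (auto simp: add.assoc[symmetric])
qed

text \<open>Commutativity turns the pairs in \<open>(A \<inter> B) \<times> B\<close> into pairs in
  \<open>B \<times> (A \<inter> B)\<close>, and together with those in
  \<open>(A - B) \<times> (A \<inter> B)\<close> they fill
  \<open>(A \<union> B) \<times> (A \<inter> B)\<close>. So the count for \<open>A\<close>,
  \<open>B\<close> is that of the Dyson transform plus a remainder.\<close>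

lemma off_Dyson:
  assumes "finite A" "finite B"
  shows "off D A B = off D (A \<union> B) (A \<inter> B) + off D (A - B) (B - A)"
proof -
  have A: "A = (A \<inter> B) \<union> (A - B)" and B: "B = (A \<inter> B) \<union> (B - A)" by auto
  have "off D A B = off D (A \<inter> B) B + off D (A - B) B"
    using assms by (subst A, subst off_Un_left) auto
  also have "off D (A - B) B = off D (A - B) (A \<inter> B) + off D (A - B) (B - A)"
    using assms by (subst B, subst off_Un_right) auto
  also have "off D (A \<inter> B) B = off D B (A \<inter> B)" by (rule off_commute)
  also have "off D B (A \<inter> B) + (off D (A - B) (A \<inter> B) + off D (A - B) (B - A)) =
      off D (B \<union> (A - B)) (A \<inter> B) + off D (A - B) (B - A)"
    using assms by (subst off_Un_left) auto
  also have "B \<union> (A - B) = A \<union> B" by auto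
  finally show ?thesis .
qed

text \<open>
  The case where no Dyson transform shrinks \<open>B\<close>: every translate of \<open>B\<close> that meets \<open>A\<close> lies in
  \<open>A\<close>, so \<open>B\<close> lies in a coset of the stabilizer of \<open>A\<close>.
\<close>
lemma card_le_if_translates_absorbed:
  fixes A B :: "'a::ab_group_add set" and M :: real
  assumes fin: "finite A" "finite B" and "A \<noteq> {}"
    and absorb: "\<And>e. A \<inter> (+) e ` B \<noteq> {} \<Longrightarrow> (+) e ` B \<subseteq> A"
    and sub: "\<And>H :: 'a set. add_subgroup H \<Longrightarrow> finite H \<Longrightarrow> real (card H) \<le> M \<Longrightarrow> card H \<le> d"
  shows "M < card A \<or> card B \<le> d"
proof (cases "B = {}")
  case False
  then obtain b0 where b0: "b0 \<in> B" by auto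
  obtain a0 where a0: "a0 \<in> A" using \<open>A \<noteq> {}\<close> by auto
  define H where "H = {h. \<forall>a\<in>A. a + h \<in> A}"
  have H: "add_subgroup H" unfolding H_def by (rule add_subgroup_stabilizer[OF fin(1)])
  have "(+) a0 ` H \<subseteq> A" using a0 by (auto simp: H_def)
  then have finH: "finite H" and HA: "card H \<le> card A"
    using fin(1) inj_on_finite[of "(+) a0" H A] card_inj_on_le[of "(+) a0" H A] by auto
  have "(\<lambda>b. b - b0) ` B \<subseteq> H"
  proof clarify
    fix b assume b: "b \<in> B"
    show "b - b0 \<in> H" unfolding H_def
    proof clarify
      fix a assume "a \<in> A"
      then have "A \<inter> (+) (a - b0) ` B \<noteq> {}" using b0 by (auto simp: image_iff intro!: bexI[of _ b0])
      from absorb[OF this] b have "(a - b0) + b \<in> A" by blast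
      then show "a + (b - b0) \<in> A" by (simp add: algebra_simps)
    qed
  qed
  then have "card B \<le> card H"
    using finH by (intro card_inj_on_le[of "\<lambda>b. b - b0"]) (auto simp: inj_on_def)
  then show ?thesis
    using sub[OF H finH] HA by linarith
qed auto

text \<open>
  Pollard's theorem in a dual form: \<open>t |D|\<close> plus the number of pairs with sum outside \<open>D\<close> is
  minimised by the set of sums with at least \<open>t\<close> representations, where its value is the sum of
  \<open>min t (r x)\<close>.
\<close>
theorem Pollard:
  fixes A B D :: "'a::ab_group_add set" and M :: real and t d :: nat
  assumes sub: "\<And>H :: 'a set. add_subgroup H \<Longrightarrow> finite H \<Longrightarrow> real (card H) \<le> M \<Longrightarrow> card H \<le> d"
    and "finite A" "finite B" "finite D" "t \<le> card B" "card B \<le> card A"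
  shows "real t * min M (real (card A) + real (card B) - real t - real d)
    \<le> real t * real (card D) + real (off D A B)"
  using assms(2-)
proof (induction "card B" arbitrary: A B D t rule: less_induct)
  case less
  note fin = \<open>finite A\<close> \<open>finite B\<close> \<open>finite D\<close>
  show ?case
  \<comment> \<open>A translate of \<open>B\<close> that meets \<open>A\<close> without lying in it
    makes both the intersection and the remainder of \<open>B\<close> smaller than \<open>B\<close>,
    so the induction on \<open>card B\<close> reaches them.\<close>
  proof (cases "\<exists>e. A \<inter> (+) e ` B \<noteq> {} \<and> \<not> (+) e ` B \<subseteq> A")
    case True
    then obtain e where e: "A \<inter> (+) e ` B \<noteq> {}" "\<not> (+) e ` B \<subseteq> A" by auto
    define B' where "B' = (+) e ` B"
    define D' where "D' = (+) e ` D"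
    have fin': "finite B'" "finite D'" using fin by (auto simp: B'_def D'_def)
    have cards: "card B' = card B" "card D' = card D"
      by (auto simp: B'_def D'_def card_image)
    have off: "off D A B = off D' (A \<union> B') (A \<inter> B') + off D' (A - B') (B' - A)"
      unfolding off_Dyson[OF fin(1) fin'(1), symmetric] unfolding B'_def D'_def
      by (rule off_translate[symmetric])
    define u where "u = card (A \<inter> B')"
    have u: "u > 0" "u < card B"
      using e fin fin' unfolding u_def B'_def[symmetric] cards(1)[symmetric]
      by (auto simp: card_gt_0_iff intro!: psubset_card_mono)
    have v: "card (A \<union> B') + u = card A + card B"
      using card_Un_Int[OF fin(1) fin'(1)] by (simp add: u_def cards)
    have cA: "card (A - B') = card A - u" and cB: "card (B' - A) = card B - u"
      using fin fin' unfolding u_def cards(1)[symmetric]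
      by (auto simp: card_Diff_subset_Int Int_commute)
    let ?N = "real (card A) + real (card B)"
    show ?thesis
    \<comment> \<open>If the intersection has \<open>t\<close> elements, the transformed pair alone
      suffices. Otherwise it gets the trivial bound with factor \<open>u\<close>, and the remainder,
      whose two parts have lost \<open>u\<close> elements each, is treated inductively with
      \<open>t - u\<close>.\<close>
    proof (cases "t \<le> u")
      case True
      have "real t * min M (real (card (A \<union> B')) + real u - real t - real d)
        \<le> real t * real (card D') + real (off D' (A \<union> B') (A \<inter> B'))"
        unfolding u_def by (rule less.hyps)
          (use True u v less.prems fin' in \<open>auto simp: u_def intro!: card_mono\<close>)
      moreover have "real (card (A \<union> B')) + real u = ?N" using v by linarith
      ultimately show ?thesis using off by (simp add: cards)
    next
      case False
      have "real (t - u) * min M (real (card (A - B')) + real (card (B' - A)) - real (t - u) - real d)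
        \<le> real (t - u) * real (card D') + real (off D' (A - B') (B' - A))"
        by (rule less.hyps) (use False u less.prems fin' in \<open>auto simp: cA cB\<close>)
      moreover have "real (card (A - B')) + real (card (B' - A)) - real (t - u) - real d = ?N - u - t - d"
        using False u less.prems unfolding cA cB by (simp add: of_nat_diff)
      ultimately have 1: "(real t - u) * min M (?N - u - t - d)
        \<le> (real t - u) * card D + real (off D' (A - B') (B' - A))"
        using False by (simp only: cards) (simp add: of_nat_diff)
      have "u * card (A \<union> B') \<le> u * card D' + off D' (A \<inter> B') (A \<union> B')"
        unfolding u_def by (rule card_times_le_off) (use fin fin' in auto)
      then have "real u * real (card (A \<union> B')) \<le> real u * real (card D) + real (off D' (A \<union> B') (A \<inter> B'))"
        by (simp add: off_commute cards flip: of_nat_mult of_nat_add)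
      moreover have "real (card (A \<union> B')) = ?N - u" using v by linarith
      ultimately have 2: "real u * (?N - u) \<le> real u * card D + real (off D' (A \<union> B') (A \<inter> B'))" by simp
      have "real t * min M (?N - t - d) \<le> (real t - u) * min M (?N - u - t - d) + real u * (?N - u)"
      proof (cases "M \<le> ?N - u - t - d")
        case True
        have "real u * min M (?N - t - d) \<le> real u * (?N - u)"
          by (intro mult_left_mono) (use False in auto)
        moreover have "(real t - u) * min M (?N - t - d) \<le> (real t - u) * M"
          by (intro mult_left_mono) (use False in auto)
        ultimately show ?thesis using True by (simp add: algebra_simps)
      next
        case M: False
        have "real t * min M (?N - t - d) \<le> real t * (?N - t - d)"
          by (intro mult_left_mono) auto
        \<comment> \<open>The two sides differ by exactly \<open>u * d\<close>.\<close>
        also have "\<dots> \<le> (real t - u) * (?N - u - t - d) + real u * (?N - u)"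
          by (simp add: algebra_simps)
        finally show ?thesis using M by simp
      qed
      with 1 2 show ?thesis unfolding off by (simp add: algebra_simps)
    qed
  next
    case False
    \<comment> \<open>In the stuck case the minimum is at most \<open>card A\<close>: either
      \<open>M < card A\<close>, or \<open>card B \<le> d\<close> makes the second argument small.
      So it is enough to bound \<open>t * card A\<close>.\<close>
    have D: "real t * real (card A) \<le> real t * real (card D) + real (off D A B)"
    proof (cases "card A \<le> card D")
      case True
      then have "real t * real (card A) \<le> real t * real (card D)" by (intro mult_left_mono) auto
      then show ?thesis by simp
    next
      case False
      have "real (card B * card A) \<le> real (card B * card D + off D B A)"
        using card_times_le_off[OF fin(2,1,3)] of_nat_le_iff by blast
      moreover have "real t * (real (card A) - card D) \<le> real (card B) * (real (card A) - card D)"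
        by (intro mult_right_mono) (use False less.prems in auto)
      ultimately show ?thesis by (simp add: algebra_simps off_commute)
    qed
    show ?thesis
    proof (cases "A = {}")
      case True
      then show ?thesis using less.prems by simp
    next
      case ne: False
      have "M < card A \<or> card B \<le> d"
        using False by (intro card_le_if_translates_absorbed[OF fin(1,2) ne _ sub]) auto
      then have "real t * min M (real (card A) + real (card B) - real t - real d) \<le> real t * real (card A)"
        by (intro mult_left_mono) auto
      then show ?thesis using D by linarith
    qed
  qed
qed

section \<open>The size of a container with few edges\<close>

text \<open>Pollard's theorem is applied with \<open>t\<close> about \<epsilon> times the smaller
  cardinality: the pairs outside \<open>D\<close> then cost a proportion \<epsilon> of the larger
  set, and the loss \<open>t\<close> a proportion \<epsilon> of the smaller one.\<close>

lemma card_add_card_le_of_few_off: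
  fixes C1 C2 D :: "'a::ab_group_add set" and \<epsilon> :: real and m d :: nat
  assumes sub: "\<And>H :: 'a set. add_subgroup H \<Longrightarrow> finite H \<Longrightarrow>
      real (card H) \<le> (1 + 4 * \<epsilon>) * m \<Longrightarrow> card H \<le> d"
    and eps: "0 < \<epsilon>" "\<epsilon> < 1 / 4" and fin: "finite C1" "finite C2" "finite D"
    and D: "card D \<le> m" and large: "3 / \<epsilon> \<le> real (card C1) + real (card C2)"
    and few: "real (off D C1 C2) < \<epsilon>\<^sup>2 * real (card C1) * real (card C2)"
  shows "real (card C1) + real (card C2) \<le> (1 + 2 * \<epsilon>) * (real m + real d)"
  using fin large few
proof (induction "card C2" "card C1" arbitrary: C1 C2 rule: linorder_wlog)
  case sym
  have "real (card C2) + real (card C1) \<le> (1 + 2 * \<epsilon>) * (real m + real d)"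
    by (rule sym.hyps) (use sym.prems in \<open>auto simp: off_commute mult_ac\<close>)
  then show ?case by simp
next
  case le
  define x y where "x = real (card C1)" and "y = real (card C2)"
  have pos: "x * y > 0"
    using le.prems by (cases "C1 = {} \<or> C2 = {}") (auto simp: x_def y_def card_gt_0_iff)
  then have xy: "y > 0" "y \<le> x" using le.hyps by (auto simp: x_def y_def zero_less_mult_iff)
  have e2: "\<epsilon>\<^sup>2 < 1 / 16"
    using power_strict_mono[OF eps(2), of 2] eps by (simp add: power2_eq_square)
  have "y * x \<le> y * card D + real (off D C2 C1)"
    using card_times_le_off[of C2 C1 D] le.prems
    unfolding x_def y_def of_nat_mult[symmetric] of_nat_add[symmetric] of_nat_le_iff by blast
  also have "\<dots> \<le> y * m + \<epsilon>\<^sup>2 * x * y"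
    using le.prems D xy by (intro add_mono mult_left_mono) (auto simp: x_def y_def off_commute)
  finally have "y * (x * (1 - \<epsilon>\<^sup>2)) \<le> y * m" by (simp add: algebra_simps)
  then have "x * (1 - \<epsilon>\<^sup>2) \<le> m" using xy by simp
  moreover have "x * (15 / 16) \<le> x * (1 - \<epsilon>\<^sup>2)" using xy e2 by (intro mult_left_mono) auto
  ultimately have xm: "x < 4 * m" using xy by linarith
  define t where "t = nat \<lceil>\<epsilon> * y\<rceil>"
  have t: "\<epsilon> * y \<le> t" "t < \<epsilon> * y + 1" "t > 0"
    using eps xy by (auto simp: t_def) linarith+
  have "\<epsilon> * y \<le> y" using eps xy by simp
  then have "\<lceil>\<epsilon> * y\<rceil> \<le> int (card C2)" unfolding y_def by (simp add: ceiling_le_iff)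
  then have "t \<le> card C2" by (simp only: t_def nat_le_iff)
  then have "real t * min ((1 + 4 * \<epsilon>) * m) (x + y - t - d) \<le> real t * card D + real (off D C1 C2)"
    unfolding x_def y_def using le by (intro Pollard sub) auto
  also have "\<dots> < real t * m + \<epsilon>\<^sup>2 * x * y"
    using le.prems D by (intro add_le_less_mono mult_left_mono) (auto simp: x_def y_def)
  also have "\<epsilon>\<^sup>2 * x * y = \<epsilon> * x * (\<epsilon> * y)" by (simp add: power2_eq_square)
  also have "\<dots> \<le> \<epsilon> * x * t" using t eps xy by (intro mult_left_mono) auto
  finally have "real t * min ((1 + 4 * \<epsilon>) * m) (x + y - t - d) < t * (m + \<epsilon> * x)"
    by (simp add: algebra_simps)
  then have "min ((1 + 4 * \<epsilon>) * m) (x + y - t - d) < m + \<epsilon> * x"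
    using t by simp
  \<comment> \<open>The crude bound \<open>x < 4 * m\<close> rules out the first argument of the
    minimum. This is why \<open>\<beta>\<close> is taken over subgroups of order up to
    \<open>(1 + 4 * \<epsilon>) * m\<close>.\<close>
  moreover have "m + \<epsilon> * x \<le> (1 + 4 * \<epsilon>) * m"
    using mult_left_mono[of x "4 * m" \<epsilon>] eps xm by (simp add: algebra_simps)
  ultimately have "x + y - t - d < m + \<epsilon> * x" by linarith
  then have 1: "(x + y) * (1 - \<epsilon>) - 1 < real m + d"
    using t by (simp add: algebra_simps)
  \<comment> \<open>Rounding \<open>t\<close> up costs 1, which \<open>large\<close> absorbs at the
    price of replacing \<epsilon> by \<open>4 / 3 * \<epsilon>\<close>.\<close>
  have "1 \<le> \<epsilon> / 3 * (x + y)"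
    using le.prems eps by (simp add: x_def y_def field_simps)
  then have 2: "(x + y) * (1 - 4 / 3 * \<epsilon>) \<le> (x + y) * (1 - \<epsilon>) - 1"
    by (simp add: algebra_simps)
  have "1 \<le> (1 + 2 * \<epsilon>) * (1 - 4 / 3 * \<epsilon>)"
  proof -
    have "0 \<le> \<epsilon> * (1 / 4 - \<epsilon>)" using eps by simp
    moreover have "(1 + 2 * \<epsilon>) * (1 - 4 / 3 * \<epsilon>) = 1 + 8 / 3 * (\<epsilon> * (1 / 4 - \<epsilon>))"
      by (simp add: field_simps)
    ultimately show ?thesis by linarith
  qed
  then have "(x + y) * 1 \<le> (x + y) * ((1 + 2 * \<epsilon>) * (1 - 4 / 3 * \<epsilon>))"
    using xy by (intro mult_left_mono) auto
  also have "\<dots> = (1 + 2 * \<epsilon>) * ((x + y) * (1 - 4 / 3 * \<epsilon>))" by simp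
  also have "\<dots> \<le> (1 + 2 * \<epsilon>) * (real m + d)" using 1 2 eps by (intro mult_left_mono) auto
  finally show ?case by (simp add: x_def y_def)
qed

lemma card_le_beta:
  fixes H :: "'a::ab_group_add set"
  assumes "add_subgroup H" "finite H" "real (card H) \<le> x"
  shows "card H \<le> beta TYPE('a) x"
proof -
  have "{card H | H :: 'a set. add_subgroup H \<and> finite H \<and> real (card H) \<le> x} \<subseteq> {..nat \<lfloor>x\<rfloor>}"
    by (auto simp: le_nat_floor)
  then have "finite {card H | H :: 'a set. add_subgroup H \<and> finite H \<and> real (card H) \<le> x}"
    by (rule finite_subset) simp
  then show ?thesis unfolding beta_def by (rule Max_ge) (use assms in auto)
qed

section \<open>Saturation\<close>

lemma off_Un_le:
  assumes "finite U" "finite U'" "finite V"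
  shows "off D (U \<union> U') V \<le> off D U V + off D U' V"
  using assms by (simp add: off_eq_sum_deg sum_Un_nat)

lemma deg_antimono: "finite S \<Longrightarrow> D \<subseteq> D' \<Longrightarrow> deg D' S x \<le> deg D S x"
  unfolding deg_def by (intro card_mono) auto

lemma off_antimono: "finite U \<Longrightarrow> finite V \<Longrightarrow> D \<subseteq> D' \<Longrightarrow> off D' U V \<le> off D U V"
  by (simp add: off_eq_sum_deg sum_mono deg_antimono)

lemma off_le_of_deg_le:
  fixes c :: real
  assumes "finite U" "finite V" "\<And>b. b \<in> V \<Longrightarrow> real (deg D U b) \<le> c"
  shows "real (off D U V) \<le> c * real (card V)"
proof -
  have "real (off D U V) = (\<Sum>b\<in>V. real (deg D U b))"
    using assms by (subst off_commute) (simp add: off_eq_sum_deg)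
  also have "\<dots> \<le> (\<Sum>b\<in>V. c)" by (intro sum_mono assms)
  finally show ?thesis by (simp add: mult.commute)
qed

text \<open>The elements counted by the degree, translated by \<open>b\<close>, are distinct new
  sums.\<close>

lemma card_sum_insert_right:
  assumes "finite X" "finite Z"
  shows "card (X + Z) + deg (X + Z) X b \<le> card (X + insert b Z)"
proof -
  let ?N = "(+) b ` {x \<in> X. b + x \<notin> X + Z}"
  have "card (X + Z) + deg (X + Z) X b = card (X + Z) + card ?N"
    by (simp add: deg_def card_image)
  also have "\<dots> = card ((X + Z) \<union> ?N)"
    using assms by (subst card_Un_disjoint) (auto intro: finite_set_plus)
  also have "\<dots> \<le> card (X + insert b Z)"
    using assms by (intro card_mono finite_set_plus) (auto simp: set_plus_def add.commute)
  finally show ?thesis .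
qed

lemma set_plus_intro_swapped: "a \<in> X \<Longrightarrow> b \<in> Z \<Longrightarrow> b + a \<in> X + (Z :: 'a::ab_group_add set)"
  by (subst add.commute) (rule set_plus_intro)

text \<open>Adding an element that violates a degree bound enlarges the sumset by at least \<tau>,
  so such additions come to an end and their number is paid for by the growth of the sumset.\<close>

lemma saturation:
  fixes X Z A B :: "'a::ab_group_add set" and \<tau> :: real
  assumes fin: "finite A" "finite B" and sub: "X \<subseteq> A" "Z \<subseteq> B" and tau: "\<tau> > 0"
  obtains X' Z' where "X \<subseteq> X'" "X' \<subseteq> A" "Z \<subseteq> Z'" "Z' \<subseteq> B"
    "\<And>a. a \<in> A \<Longrightarrow> real (deg (X' + Z') Z' a) < \<tau>"
    "\<And>b. b \<in> B \<Longrightarrow> real (deg (X' + Z') X' b) < \<tau>"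
    "\<tau> * (real (card (X' - X)) + real (card (Z' - Z))) + real (card (X + Z)) \<le> real (card (X' + Z'))"
proof -
  \<comment> \<open>The process is replaced by an extremal choice: among the extensions meeting the
    cost bound, one with the largest sumset. A violating element could be added without leaving
    \<open>P\<close>.\<close>
  define P where "P = (\<lambda>(X', Z'). X \<subseteq> X' \<and> X' \<subseteq> A \<and> Z \<subseteq> Z' \<and> Z' \<subseteq> B \<and>
    \<tau> * (real (card (X' - X)) + real (card (Z' - Z))) + real (card (X + Z)) \<le> real (card (X' + Z')))"
  have "finite {p. P p}"
    by (rule finite_subset[of _ "Pow A \<times> Pow B"]) (use fin in \<open>auto simp: P_def\<close>)
  moreover have "(X, Z) \<in> {p. P p}" using sub by (auto simp: P_def)
  ultimately have "Max ((\<lambda>p. card (fst p + snd p)) ` {p. P p}) \<in> (\<lambda>p. card (fst p + snd p)) ` {p. P p}"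
    by (intro Max_in) auto
  then obtain p where p: "p \<in> {p. P p}"
      and "card (fst p + snd p) = Max ((\<lambda>p. card (fst p + snd p)) ` {p. P p})" by auto
  then have max: "card (fst p' + snd p') \<le> card (fst p + snd p)" if "P p'" for p'
    using \<open>finite {p. P p}\<close> that by (auto intro!: Max_ge)
  obtain X' Z' where [simp]: "p = (X', Z')" by (cases p)
  have P: "X \<subseteq> X'" "X' \<subseteq> A" "Z \<subseteq> Z'" "Z' \<subseteq> B" and
    c: "\<tau> * (real (card (X' - X)) + real (card (Z' - Z))) + real (card (X + Z)) \<le> real (card (X' + Z'))"
    using p by (auto simp: P_def)
  have fin': "finite X'" "finite Z'" using P fin finite_subset by blast+
  show ?thesis
  proof (rule that[OF P _ _ c])
    fix a assume a: "a \<in> A"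
    show "real (deg (X' + Z') Z' a) < \<tau>"
    proof (rule ccontr)
      assume "\<not> ?thesis"
      then have d: "\<tau> \<le> deg (X' + Z') Z' a" by simp
      then have "deg (X' + Z') Z' a \<noteq> 0" using tau by linarith
      \<comment> \<open>Elements of \<open>X'\<close> have degree 0, so a violating element is new
        and is counted in the cost.\<close>
      then have "a \<notin> X'" unfolding deg_def by (auto simp: card_eq_0_iff intro: set_plus_intro)
      moreover have "insert a X' - X = insert a (X' - X)" using \<open>a \<notin> X'\<close> P by auto
      ultimately have "real (card (insert a X' - X)) = real (card (X' - X)) + 1" using fin' by simp
      moreover have "card (X' + Z') + deg (X' + Z') Z' a \<le> card (insert a X' + Z')"
        using card_sum_insert_right[OF fin'(2,1), of a] by (simp add: add.commute)
      then have g: "real (card (X' + Z')) + \<tau> \<le> card (insert a X' + Z')" using d by linarith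
      ultimately have "P (insert a X', Z')"
        using P a c by (auto simp: P_def algebra_simps)
      with max[of "(insert a X', Z')"] g tau show False by simp
    qed
  next
    fix b assume b: "b \<in> B"
    show "real (deg (X' + Z') X' b) < \<tau>"
    proof (rule ccontr)
      assume "\<not> ?thesis"
      then have d: "\<tau> \<le> deg (X' + Z') X' b" by simp
      then have "deg (X' + Z') X' b \<noteq> 0" using tau by linarith
      then have "b \<notin> Z'" unfolding deg_def by (auto simp: card_eq_0_iff intro: set_plus_intro_swapped)
      moreover have "insert b Z' - Z = insert b (Z' - Z)" using \<open>b \<notin> Z'\<close> P by auto
      ultimately have "real (card (insert b Z' - Z)) = real (card (Z' - Z)) + 1" using fin' by simp
      moreover have g: "real (card (X' + Z')) + \<tau> \<le> card (X' + insert b Z')"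
        using card_sum_insert_right[OF fin'(1,2), of b] d by linarith
      ultimately have "P (X', insert b Z')"
        using P b c by (auto simp: P_def algebra_simps)
      with max[of "(X', insert b Z')"] g tau show False by simp
    qed
  qed
qed

text \<open>By \<open>deg\<close>, many pairs in \<open>F \<times> V\<close> have their sum outside
  \<open>D\<close>. Such a pair has its second entry in \<open>V - V'\<close>, or its sum in
  \<open>D' - D\<close>, or its second entry in \<open>V'\<close> and its sum outside
  \<open>D'\<close>; the last kind is rare by the choice of \<open>V'\<close>. So reading
  \<open>F\<close> makes \<open>D\<close> grow or \<open>V\<close> shrink.\<close>

lemma progress:
  fixes \<tau> \<theta> :: real
  assumes fin: "finite F" "finite V" "finite X'" "finite D'"
    and sub: "F \<subseteq> X'" "D \<subseteq> D'"
    and deg: "\<And>a. a \<in> F \<Longrightarrow> \<theta> * card V \<le> deg D V a"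
    and tau: "\<tau> \<ge> 0"
  defines "V' \<equiv> {b \<in> V. real (deg D' X' b) < \<tau>}"
  shows "(\<theta> * card F - \<tau>) * card V \<le> card F * (real (card D') - real (card D) + real (card V) - real (card V'))"
proof -
  have V': "V' \<subseteq> V" by (auto simp: V'_def)
  then have finV': "finite V'" using fin finite_subset by blast
  have "card F * (\<theta> * card V) = (\<Sum>a\<in>F. \<theta> * card V)" by simp
  also have "\<dots> \<le> (\<Sum>a\<in>F. real (deg D V a))" by (intro sum_mono deg)
  also have "\<dots> = real (off D F V)" using fin by (simp add: off_eq_sum_deg)
  also have "off D F V = off D F V' + off D F (V - V')"
    using off_Un_right[of F V' "V - V'" D] fin finV' V' by (simp add: Un_absorb1)
  also have "off D F V' \<le> off D' F V' + card F * card (D' - D)"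
  proof -
    have *: "deg D V' a \<le> deg D' V' a + card (D' - D)" for a
    proof -
      have "deg D V' a \<le> card ({y \<in> V'. a + y \<notin> D'} \<union> {y \<in> V'. a + y \<in> D' - D})"
        unfolding deg_def using finV' by (intro card_mono) auto
      also have "\<dots> \<le> deg D' V' a + card {y \<in> V'. a + y \<in> D' - D}"
        unfolding deg_def by (rule card_Un_le)
      also have "card {y \<in> V'. a + y \<in> D' - D} \<le> card (D' - D)"
        by (intro card_inj_on_le[where f = "(+) a"]) (use fin in auto)
      finally show ?thesis by simp
    qed
    have "off D F V' \<le> (\<Sum>a\<in>F. deg D' V' a + card (D' - D))"
      using fin finV' by (simp add: off_eq_sum_deg sum_mono *)
    then show ?thesis using fin finV' by (simp add: off_eq_sum_deg sum.distrib)
  qed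
  also have "off D F (V - V') \<le> card F * card (V - V')"
    using sum_mono[of F "deg D (V - V')" "\<lambda>_. card (V - V')"] fin
    by (simp add: off_eq_sum_deg deg_le_card)
  finally have "card F * (\<theta> * card V) \<le> real (off D' F V') + card F * (real (card (D' - D)) + real (card (V - V')))"
    by (simp add: algebra_simps)
  moreover have "real (off D' F V') \<le> \<tau> * card V'"
  proof (rule off_le_of_deg_le[OF fin(1) finV'])
    fix b assume "b \<in> V'"
    moreover have "deg D' F b \<le> deg D' X' b"
      unfolding deg_def using fin sub by (intro card_mono) auto
    ultimately show "real (deg D' F b) \<le> \<tau>" by (auto simp: V'_def)
  qed
  moreover have "\<tau> * card V' \<le> \<tau> * card V"
    using V' fin tau by (intro mult_left_mono) (auto intro: card_mono)
  moreover have "real (card (D' - D)) = real (card D') - real (card D)"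
    using fin sub by (simp add: card_Diff_subset finite_subset card_mono of_nat_diff)
  moreover have "real (card (V - V')) = real (card V) - real (card V')"
    using fin V' finV' by (simp add: card_Diff_subset card_mono of_nat_diff)
  ultimately show ?thesis by (simp add: algebra_simps)
qed

section \<open>Fingerprints\<close>

text \<open>
  A fingerprint is a word, and a container is the state the word leads to, so counting containers
  amounts to counting words. In a state \<open>(X, Z, U, V)\<close>, the sets \<open>X\<close> and \<open>Z\<close> consist of the elements
  of \<open>A\<close> and \<open>B\<close> read so far, and \<open>U\<close>, \<open>V\<close> are the current containers of \<open>A\<close>, \<open>B\<close>. The letter \<open>Idle\<close>
  pads words to a common length.
\<close>

datatype 'a letter = InsL 'a | InsR 'a | Saturate | LowL | LowR | Idle

type_synonym 'a state = "'a set \<times> 'a set \<times> 'a set \<times> 'a set"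

text \<open>No letter consults \<open>A\<close> or \<open>B\<close>: the word alone determines the
  container. \<open>LowL\<close> and \<open>LowR\<close> put back the elements already read, which
  may have high degree but are known to be needed.\<close>

fun step :: "real \<Rightarrow> real \<Rightarrow> 'a::ab_group_add state \<Rightarrow> 'a letter \<Rightarrow> 'a state" where
  "step \<tau> \<theta> (X, Z, U, V) (InsL y) = (insert y X, Z, U, V)"
| "step \<tau> \<theta> (X, Z, U, V) (InsR y) = (X, insert y Z, U, V)"
| "step \<tau> \<theta> (X, Z, U, V) Saturate =
    (X, Z, {a \<in> U. real (deg (X + Z) Z a) < \<tau>}, {b \<in> V. real (deg (X + Z) X b) < \<tau>})"
| "step \<tau> \<theta> (X, Z, U, V) LowL = (X, Z, {a \<in> U. real (deg (X + Z) V a) < \<theta> * card V} \<union> X, V)"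
| "step \<tau> \<theta> (X, Z, U, V) LowR = (X, Z, U, {b \<in> V. real (deg (X + Z) U b) < \<theta> * card U} \<union> Z)"
| "step \<tau> \<theta> \<sigma> Idle = \<sigma>"

definition letters :: "'a set \<Rightarrow> 'a letter set" where
  "letters Y = InsL ` Y \<union> InsR ` Y \<union> {Saturate, LowL, LowR, Idle}"

primrec states :: "real \<Rightarrow> real \<Rightarrow> 'a::ab_group_add set \<Rightarrow> nat \<Rightarrow> 'a state set" where
  "states \<tau> \<theta> Y 0 = {({}, {}, Y, Y)}"
| "states \<tau> \<theta> Y (Suc k) = (\<lambda>(\<sigma>, l). step \<tau> \<theta> \<sigma> l) ` (states \<tau> \<theta> Y k \<times> letters Y)"

lemma finite_letters: "finite Y \<Longrightarrow> finite (letters Y)"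
  by (simp add: letters_def)

lemma card_letters_le:
  assumes "finite Y"
  shows "card (letters Y) \<le> 2 * card Y + 4"
proof -
  have "card (letters Y) \<le> card (InsL ` Y \<union> InsR ` Y) + card {Saturate, LowL, LowR, Idle :: 'a letter}"
    unfolding letters_def by (rule card_Un_le)
  also have "card (InsL ` Y \<union> InsR ` Y) \<le> card Y + card Y"
    by (rule order_trans[OF card_Un_le add_mono]) (use assms in \<open>auto intro: card_image_le\<close>)
  finally show ?thesis by simp
qed

lemma finite_states: "finite Y \<Longrightarrow> finite (states \<tau> \<theta> Y k)"
  by (induction k) (auto simp: finite_letters)

lemma card_states_le:
  assumes "finite Y"
  shows "card (states \<tau> \<theta> Y k) \<le> (2 * card Y + 4) ^ k"
proof (induction k)
  case (Suc k)
  have "card (states \<tau> \<theta> Y (Suc k)) \<le> card (states \<tau> \<theta> Y k \<times> letters Y)"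
    unfolding states.simps by (intro card_image_le) (simp add: assms finite_states finite_letters)
  also have "\<dots> \<le> (2 * card Y + 4) ^ k * (2 * card Y + 4)"
    unfolding card_cartesian_product by (intro mult_mono Suc card_letters_le assms) auto
  finally show ?case by (simp add: mult.commute)
qed simp

lemma states_step: "\<sigma> \<in> states \<tau> \<theta> Y k \<Longrightarrow> l \<in> letters Y \<Longrightarrow> step \<tau> \<theta> \<sigma> l \<in> states \<tau> \<theta> Y (Suc k)"
  by force

lemma states_mono:
  assumes "\<sigma> \<in> states \<tau> \<theta> Y k" "k \<le> l"
  shows "\<sigma> \<in> states \<tau> \<theta> Y l"
  using assms(2)
proof (induction l rule: dec_induct)
  case (step l)
  then show ?case using states_step[OF step.IH, of Idle] by (simp add: letters_def)
qed (rule assms(1))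

lemma states_insert_left:
  assumes "(X, Z, U, V) \<in> states \<tau> \<theta> Y k" "finite F" "F \<subseteq> Y"
  shows "(X \<union> F, Z, U, V) \<in> states \<tau> \<theta> Y (k + card F)"
  using assms(2,3)
proof (induction F)
  case (insert y F)
  then show ?case using states_step[of _ \<tau> \<theta> Y "k + card F" "InsL y"] by (force simp: letters_def)
qed (use assms in simp)

text \<open>Exchanging left and right in every letter is a symmetry of the process, by which
  arguments about \<open>A\<close> transfer to \<open>B\<close>.\<close>

lemma states_swap: "(X, Z, U, V) \<in> states \<tau> \<theta> Y k \<Longrightarrow> (Z, X, V, U) \<in> states \<tau> \<theta> Y k"
proof (induction k arbitrary: X Z U V)
  case (Suc k)
  then obtain X' Z' U' V' l where *: "(X', Z', U', V') \<in> states \<tau> \<theta> Y k" "l \<in> letters Y"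
      "(X, Z, U, V) = step \<tau> \<theta> (X', Z', U', V') l" by auto
  note ih = Suc.IH[OF *(1)]
  show ?case
  proof (cases l)
    case (InsL y)
    then show ?thesis using * states_step[OF ih, of "InsR y"] by (auto simp: letters_def)
  next
    case (InsR y)
    then show ?thesis using * states_step[OF ih, of "InsL y"] by (auto simp: letters_def)
  next
    case Saturate
    then show ?thesis using * states_step[OF ih, of Saturate] by (simp add: letters_def add.commute)
  next
    case LowL
    then show ?thesis using * states_step[OF ih, of LowR] by (simp add: letters_def add.commute)
  next
    case LowR
    then show ?thesis using * states_step[OF ih, of LowL] by (simp add: letters_def add.commute)
  next
    case Idle
    then show ?thesis using * states_step[OF ih, of Idle] by (simp add: letters_def)
  qed
qed simp

lemma states_insert:
  assumes "(X, Z, U, V) \<in> states \<tau> \<theta> Y k" "finite Y" "X \<subseteq> X'" "X' \<subseteq> Y" "Z \<subseteq> Z'" "Z' \<subseteq> Y"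
  shows "(X', Z', U, V) \<in> states \<tau> \<theta> Y (k + card (X' - X) + card (Z' - Z))"
proof -
  have "(X \<union> (X' - X), Z, U, V) \<in> states \<tau> \<theta> Y (k + card (X' - X))"
    using assms by (intro states_insert_left) (auto intro: finite_subset)
  then have "(Z, X', V, U) \<in> states \<tau> \<theta> Y (k + card (X' - X))"
    using assms by (simp add: Un_absorb1 states_swap)
  then have "(Z \<union> (Z' - Z), X', V, U) \<in> states \<tau> \<theta> Y (k + card (X' - X) + card (Z' - Z))"
    using assms by (intro states_insert_left) (auto intro: finite_subset)
  then show ?thesis
    using assms by (simp add: Un_absorb1 states_swap)
qed

section \<open>Containers for a fixed pair\<close>

text \<open>The number \<open>s\<close> is how many elements a round reads. The assumptions are
  symmetric in \<open>A\<close> and \<open>B\<close>, so the locale can be interpreted with the two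
  exchanged.\<close>

locale sumset_pair =
  fixes Y A B :: "'a::ab_group_add set" and m s :: nat and \<epsilon> :: real
  assumes finY: "finite Y" and AY: "A \<subseteq> Y" and BY: "B \<subseteq> Y"
    and card_sum: "card (A + B) \<le> m" and eps: "0 < \<epsilon>" "\<epsilon> < 1 / 4"
    and s: "0 < s" "s \<le> card A" "s \<le> card B"
begin

text \<open>Half of \<open>\<theta> * s\<close>: in \<open>progress\<close>, the loss \<tau> then
  uses up only half of what \<open>s\<close> elements gain.\<close>

definition \<tau> :: real where "\<tau> = \<epsilon>\<^sup>2 * s / 4"
text \<open>Half of the permitted density \<open>\<epsilon>\<^sup>2\<close>; the other half pays, in
  \<open>finish\<close>, for the elements that were read.\<close>

definition \<theta> :: real where "\<theta> = \<epsilon>\<^sup>2 / 2"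

abbreviation reachable :: "nat \<Rightarrow> 'a state set" where
  "reachable \<equiv> states \<tau> \<theta> Y"

definition admissible :: "'a state \<Rightarrow> bool" where
  "admissible = (\<lambda>(X, Z, U, V). X \<subseteq> A \<and> Z \<subseteq> B \<and> A \<subseteq> U \<and> U \<subseteq> Y \<and> B \<subseteq> V \<and> V \<subseteq> Y)"

definition saturated :: "'a state \<Rightarrow> bool" where
  "saturated = (\<lambda>(X, Z, U, V). (\<forall>a\<in>U. real (deg (X + Z) Z a) < \<tau>) \<and> (\<forall>b\<in>V. real (deg (X + Z) X b) < \<tau>))"

definition container_within :: "nat \<Rightarrow> bool" where
  "container_within L \<longleftrightarrow> (\<exists>X Z U V. (X, Z, U, V) \<in> reachable L \<and> admissible (X, Z, U, V) \<and>
    ((real (card U) \<le> real m / 4 \<and> real (card V) \<le> real m / 4) \<or>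
     real (off (X + Z) U V) < \<epsilon>\<^sup>2 * real (card U) * real (card V)))"

lemma container_within_mono: "container_within k \<Longrightarrow> k \<le> l \<Longrightarrow> container_within l"
  unfolding container_within_def by (metis states_mono)

lemma tau_pos: "\<tau> > 0" and theta_pos: "\<theta> > 0" and tau_theta: "\<tau> = \<theta> * s / 2"
  using eps s by (auto simp: \<tau>_def \<theta>_def)

lemma fin: "finite A" "finite B" "finite (A + B)"
  using finY AY BY by (auto intro: finite_subset finite_set_plus)

lemma card_sum_le: "X \<subseteq> A \<Longrightarrow> Z \<subseteq> B \<Longrightarrow> card (X + Z) \<le> card (A + B)"
  by (intro card_mono fin set_plus_mono2)

lemma sumset_pair_swap: "sumset_pair Y B A m s \<epsilon>"
  using finY AY BY card_sum eps s by unfold_locales (auto simp: add.commute)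

text \<open>The word reads \<open>F\<close>, \<open>G\<close> and the elements found by
  \<open>saturation\<close>, then applies \<open>Saturate\<close>, which discards nothing from
  \<open>A\<close> or \<open>B\<close>. Apart from \<open>F\<close>, \<open>G\<close> and one
  letter, the cost is the growth of \<open>X + Z\<close> divided by \<tau>, which telescopes over
  the whole process.\<close>

lemma saturate_state:
  assumes st: "(X, Z, U, V) \<in> reachable k" and adm: "admissible (X, Z, U, V)"
    and FG: "F \<subseteq> A" "G \<subseteq> B"
  obtains X' Z' U' V' k' where "(X', Z', U', V') \<in> reachable k'"
    "admissible (X', Z', U', V')" "saturated (X', Z', U', V')"
    "X \<union> F \<subseteq> X'" "Z \<union> G \<subseteq> Z'" "U' \<subseteq> U" "V' = {b \<in> V. real (deg (X' + Z') X' b) < \<tau>}"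
    "real k' \<le> real k + real (card F) + real (card G) + 1 + (real (card (X' + Z')) - real (card (X + Z))) / \<tau>"
proof -
  have sub: "X \<subseteq> A" "Z \<subseteq> B" "A \<subseteq> U" "U \<subseteq> Y" "B \<subseteq> V" "V \<subseteq> Y" using adm by (auto simp: admissible_def)
  have subs: "X \<union> F \<subseteq> A" "Z \<union> G \<subseteq> B" using sub FG by auto
  obtain X' Z' where X': "X \<union> F \<subseteq> X'" "X' \<subseteq> A" "Z \<union> G \<subseteq> Z'" "Z' \<subseteq> B"
    and sat: "\<And>a. a \<in> A \<Longrightarrow> real (deg (X' + Z') Z' a) < \<tau>"
      "\<And>b. b \<in> B \<Longrightarrow> real (deg (X' + Z') X' b) < \<tau>"
    and cost: "\<tau> * (real (card (X' - (X \<union> F))) + real (card (Z' - (Z \<union> G)))) + real (card ((X \<union> F) + (Z \<union> G)))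
        \<le> real (card (X' + Z'))"
    using saturation[OF fin(1,2) subs tau_pos] by metis
  have fin': "finite X'" "finite Z'" using X' fin finite_subset by blast+
  have "(X', Z', U, V) \<in> reachable (k + card (X' - X) + card (Z' - Z))"
    using X' AY BY by (intro states_insert[OF st finY]) auto
  from states_step[OF this, of Saturate]
  have "(X', Z', {a \<in> U. real (deg (X' + Z') Z' a) < \<tau>}, {b \<in> V. real (deg (X' + Z') X' b) < \<tau>})
      \<in> reachable (Suc (k + card (X' - X) + card (Z' - Z)))"
    by (simp add: letters_def)
  then show ?thesis
  proof (rule that)
    have 1: "card (X' - X) \<le> card (X' - (X \<union> F)) + card F"
      using fin' FG fin by (intro order_trans[OF card_mono card_Un_le]) (auto intro: finite_subset)
    have 2: "card (Z' - Z) \<le> card (Z' - (Z \<union> G)) + card G"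
      using fin' FG fin by (intro order_trans[OF card_mono card_Un_le]) (auto intro: finite_subset)
    have "card (X + Z) \<le> card ((X \<union> F) + (Z \<union> G))"
      using X' fin' by (intro card_mono finite_set_plus set_plus_mono2) (auto intro: finite_subset)
    then have "\<tau> * (real (card (X' - (X \<union> F))) + real (card (Z' - (Z \<union> G)))) \<le> real (card (X' + Z')) - real (card (X + Z))"
      using cost by linarith
    then have "real (card (X' - (X \<union> F))) + real (card (Z' - (Z \<union> G))) \<le> (real (card (X' + Z')) - real (card (X + Z))) / \<tau>"
      using tau_pos by (simp add: pos_le_divide_eq mult.commute)
    then show "real (Suc (k + card (X' - X) + card (Z' - Z)))
      \<le> real k + real (card F) + real (card G) + 1 + (real (card (X' + Z')) - real (card (X + Z))) / \<tau>"
      using 1 2 by linarith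
  qed (use X' sub sat in \<open>auto simp: admissible_def saturated_def\<close>)
qed

text \<open>
  The elements of \<open>A\<close> of high degree are few enough to be listed explicitly, so that all others can
  be discarded.
\<close>
lemma finish:
  assumes st: "(X, Z, U, V) \<in> reachable k" and adm: "admissible (X, Z, U, V)" "saturated (X, Z, U, V)"
    and F: "F \<subseteq> A" "\<And>a. a \<in> A \<Longrightarrow> \<theta> * card V \<le> deg (X + Z) V a \<Longrightarrow> a \<in> X \<union> F"
    and small: "card F + \<tau> < \<theta> * card A"
  shows "container_within (k + card F + 1)"
proof -
  have sub: "X \<subseteq> A" "Z \<subseteq> B" "A \<subseteq> U" "U \<subseteq> Y" "B \<subseteq> V" "V \<subseteq> Y" using adm by (auto simp: admissible_def)
  have fin': "finite X" "finite F" "finite U" "finite V" using sub F fin finY finite_subset by metis+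
  define D where "D = X + Z"
  define D' where "D' = (X \<union> F) + Z"
  define W where "W = {a \<in> U. real (deg D' V a) < \<theta> * card V}"
  have DD: "D \<subseteq> D'" unfolding D_def D'_def by (intro set_plus_mono2) auto
  have "(X \<union> F, Z, U, V) \<in> reachable (k + card F)"
    using F AY by (intro states_insert_left st fin') auto
  from states_step[OF this, of LowL] have "(X \<union> F, Z, W \<union> (X \<union> F), V) \<in> reachable (k + card F + 1)"
    by (simp add: letters_def W_def D'_def)
  moreover have "a \<in> W \<union> (X \<union> F)" if "a \<in> A" for a
    using F(2)[OF that] deg_antimono[OF fin'(4) DD, of a] that sub unfolding W_def D_def by force
  then have AW: "A \<subseteq> W \<union> (X \<union> F)" by blast
  then have "admissible (X \<union> F, Z, W \<union> (X \<union> F), V)"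
    using sub F AY by (auto simp: admissible_def W_def)
  \<comment> \<open>\<open>W\<close> contributes at most \<open>\<theta> * card V\<close> per
    element. \<open>X\<close> contributes at most \<open>\<tau> * card V\<close> by saturation and
    \<open>F\<close> at most \<open>card F * card V\<close>; by \<open>small\<close>, these two
    together stay below another \<theta> share, and \<open>2 * \<theta>\<close> is
    \<open>\<epsilon>\<^sup>2\<close>.\<close>
  moreover have "real (off D' (W \<union> (X \<union> F)) V) < \<epsilon>\<^sup>2 * real (card (W \<union> (X \<union> F))) * real (card V)"
  proof -
    have finW: "finite W" using fin' by (auto simp: W_def)
    have "card B > 0" using s by simp
    then have V: "card V > 0" using card_mono[OF fin'(4) sub(5)] by simp
    have "off D' (W \<union> (X \<union> F)) V \<le> off D' W V + (off D' X V + off D' F V)"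
      using off_Un_le[of W "X \<union> F" V D'] off_Un_le[of X F V D'] fin' finW by simp
    moreover have "real (off D' W V) \<le> \<theta> * card V * card W"
      using off_le_of_deg_le[of V W D' "\<theta> * card V"] fin' finW by (auto simp: W_def off_commute)
    moreover have "off D' X V \<le> off D X V" by (rule off_antimono[OF fin'(1,4) DD])
    moreover have "real (off D X V) \<le> \<tau> * card V"
      using adm fin' by (intro off_le_of_deg_le) (auto simp: saturated_def D_def less_imp_le)
    moreover have "real (off D' F V) \<le> real (card F) * card V"
      using fin' by (intro off_le_of_deg_le) (auto simp: deg_le_card)
    ultimately have "real (off D' (W \<union> (X \<union> F)) V) \<le> \<theta> * card V * card W + (\<tau> + card F) * card V"
      by (simp add: algebra_simps)
    also have "(\<tau> + card F) * card V < \<theta> * card A * card V"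
      using small V by (intro mult_strict_right_mono) auto
    also have "\<theta> * card A * card V \<le> \<theta> * card (W \<union> (X \<union> F)) * card V"
      using AW finW fin' theta_pos by (intro mult_left_mono mult_right_mono) (auto intro: card_mono)
    also have "\<theta> * card V * card W \<le> \<theta> * card V * card (W \<union> (X \<union> F))"
      using finW fin' theta_pos by (intro mult_left_mono) (auto intro: card_mono)
    finally show ?thesis by (simp add: \<theta>_def mult_ac)
  qed
  ultimately show ?thesis unfolding container_within_def D'_def by blast
qed

text \<open>If fewer than \<open>s\<close> elements of \<open>A\<close> have high degree,
  \<open>finish\<close> lists them all, against \<open>stuck\<close>. Otherwise \<open>s\<close> of
  them are read, and \<open>progress\<close> together with \<open>card V > m / 4\<close> gives the
  drop.\<close>

lemma round:
  assumes st: "(X, Z, U, V) \<in> reachable k" and adm: "admissible (X, Z, U, V)" "saturated (X, Z, U, V)"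
    and large: "card V > real m / 4" "s + \<tau> \<le> \<theta> * card A"
    and stuck: "\<not> container_within (k + s + 1)"
  obtains X' Z' U' V' k' where "(X', Z', U', V') \<in> reachable k'"
    "admissible (X', Z', U', V')" "saturated (X', Z', U', V')"
    "real k' \<le> real k + s + 1 + (real (card (X' + Z')) - real (card (X + Z))) / \<tau>"
    "\<epsilon>\<^sup>2 * m / 16 \<le> (real (card U) + real (card V) - real (card (X + Z))) -
      (real (card U') + real (card V') - real (card (X' + Z')))"
proof -
  have sub: "X \<subseteq> A" "Z \<subseteq> B" "A \<subseteq> U" "U \<subseteq> Y" "B \<subseteq> V" "V \<subseteq> Y" using adm by (auto simp: admissible_def)
  have fin': "finite U" "finite V" using sub finY finite_subset by metis+
  define H where "H = {a \<in> A. \<theta> * card V \<le> deg (X + Z) V a}"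
  have "card H \<ge> s"
  proof (rule ccontr)
    assume *: "\<not> s \<le> card H"
    then have "container_within (k + card H + 1)"
      using large by (intro finish[OF st adm]) (auto simp: H_def)
    then show False using stuck * container_within_mono by auto
  qed
  then obtain F where F: "F \<subseteq> H" "card F = s" by (metis obtain_subset_with_card_n)
  then have FA: "F \<subseteq> A" by (auto simp: H_def)
  obtain X' Z' U' V' k' where new: "(X', Z', U', V') \<in> reachable k'"
      "admissible (X', Z', U', V')" "saturated (X', Z', U', V')"
      "X \<union> F \<subseteq> X'" "Z \<union> {} \<subseteq> Z'" "U' \<subseteq> U" and V': "V' = {b \<in> V. real (deg (X' + Z') X' b) < \<tau>}"
      and cost: "real k' \<le> real k + real (card F) + real (card ({} :: 'a set)) + 1 +
        (real (card (X' + Z')) - real (card (X + Z))) / \<tau>"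
    by (rule saturate_state[OF st adm(1) FA empty_subsetI])
  have fin'': "finite X'" "finite Z'" "finite F"
    using new(2) fin FA finite_subset unfolding admissible_def by auto
  have "(\<theta> * card F - \<tau>) * card V \<le> card F * (real (card (X' + Z')) - real (card (X + Z)) + real (card V) - real (card V'))"
    unfolding V'
    by (rule progress) (use new F fin' fin'' tau_pos in \<open>auto simp: H_def intro: finite_set_plus set_plus_mono2[THEN subsetD]\<close>)
  also have "(\<theta> * card F - \<tau>) * card V = real s * (\<epsilon>\<^sup>2 / 4 * card V)"
    unfolding F(2) by (simp add: \<theta>_def \<tau>_def field_simps)
  finally have "\<epsilon>\<^sup>2 / 4 * card V \<le> real (card (X' + Z')) - real (card (X + Z)) + real (card V) - real (card V')"
    using s(1) F(2) by (simp only: mult_le_cancel_left_pos of_nat_0_less_iff)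
  moreover have "\<epsilon>\<^sup>2 * m / 16 \<le> \<epsilon>\<^sup>2 / 4 * card V"
    using mult_left_mono[of "m / 4" "card V" "\<epsilon>\<^sup>2 / 4"] large by simp
  moreover have "card U' \<le> card U" using new fin' by (auto intro: card_mono)
  ultimately have "\<epsilon>\<^sup>2 * m / 16 \<le> (real (card U) + real (card V) - real (card (X + Z))) -
      (real (card U') + real (card V') - real (card (X' + Z')))"
    by linarith
  then show ?thesis using that[OF new(1-3)] cost F(2) by simp
qed

end

section \<open>Iterating the rounds and counting letters\<close>

text \<open>Induction on the potential \<open>card U + card V - card (X + Z)\<close>, to which
  \<open>card (A + B)\<close> is added to keep it nonnegative. The last \<open>s + 1\<close> letters
  of the budget are reserved for \<open>finish\<close>.\<close>

lemma (in sumset_pair) container_by_rounds: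
  assumes "(X, Z, U, V) \<in> reachable k" "admissible (X, Z, U, V)" "saturated (X, Z, U, V)"
    and large: "s + \<tau> \<le> \<theta> * card A" "s + \<tau> \<le> \<theta> * card B" and m: "m > 0"
    and "real k + (s + 1) * (16 / (\<epsilon>\<^sup>2 * m)) * (real (card U) + real (card V) + real (card (A + B)) - real (card (X + Z)))
      + (real (card (A + B)) - real (card (X + Z))) / \<tau> + s + 1 \<le> real L"
  shows "container_within L"
  using assms(1-3,7)
proof (induction "card U + card V + card (A + B) - card (X + Z)" arbitrary: X Z U V k rule: less_induct)
  case less
  \<comment> \<open>The thresholds and the reachable states do not mention \<open>A\<close> or
    \<open>B\<close>, so they are the same in the swapped copy, which serves the rounds where
    \<open>U\<close> is the large container.\<close>
  interpret sw: sumset_pair Y B A m s \<epsilon> by (rule sumset_pair_swap)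
  have adm_sw: "sw.admissible (Z, X, V, U) \<longleftrightarrow> admissible (X, Z, U, V)" for X Z U V
    by (auto simp: sw.admissible_def admissible_def)
  have sat_sw: "sw.saturated (Z, X, V, U) \<longleftrightarrow> saturated (X, Z, U, V)" for X Z U V
    by (auto simp: sw.saturated_def saturated_def add.commute)
  have within_sw: "container_within l" if "sw.container_within l" for l
  proof -
    from that obtain X Z U V where *: "(X, Z, U, V) \<in> reachable l" "sw.admissible (X, Z, U, V)"
      "(real (card U) \<le> real m / 4 \<and> real (card V) \<le> real m / 4) \<or>
       real (off (X + Z) U V) < \<epsilon>\<^sup>2 * real (card U) * real (card V)"
      unfolding sw.container_within_def by blast
    have "admissible (Z, X, V, U)" using *(2) adm_sw by blast
    moreover have "(Z, X, V, U) \<in> reachable l" using *(1) by (rule states_swap)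
    ultimately show ?thesis using *(3) unfolding container_within_def
      by (intro exI[of _ Z] exI[of _ X] exI[of _ V] exI[of _ U])
        (auto simp: add.commute[of Z X] off_commute[of _ V U] mult_ac)
  qed
  have XZ: "card (X + Z) \<le> card (A + B)"
    using less.prems by (auto simp: admissible_def intro: card_sum_le)
  have "0 \<le> (s + 1) * (16 / (\<epsilon>\<^sup>2 * m)) * (real (card U) + real (card V) + real (card (A + B)) - real (card (X + Z)))"
    using XZ by (intro mult_nonneg_nonneg) auto
  moreover have "0 \<le> (real (card (A + B)) - real (card (X + Z))) / \<tau>" using XZ tau_pos by simp
  ultimately have kL: "k + s + 1 \<le> L" using less.prems(4) by linarith
  show ?case
  proof (rule ccontr)
    assume not: "\<not> container_within L"
    then have stuck: "\<not> container_within (k + s + 1)" using kL container_within_mono by blast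
    then have stuck_sw: "\<not> sw.container_within (k + s + 1)" using within_sw by blast
    have "\<not> container_within k" using stuck container_within_mono[of k "k + s + 1"] by auto
    then have big: "card U > real m / 4 \<or> card V > real m / 4"
      using less.prems unfolding container_within_def by (meson not_le)
    have "\<exists>X' Z' U' V' k'. (X', Z', U', V') \<in> reachable k' \<and>
      admissible (X', Z', U', V') \<and> saturated (X', Z', U', V') \<and>
      real k' \<le> real k + s + 1 + (real (card (X' + Z')) - real (card (X + Z))) / \<tau> \<and>
      \<epsilon>\<^sup>2 * m / 16 \<le> (real (card U) + real (card V) - real (card (X + Z))) -
        (real (card U') + real (card V') - real (card (X' + Z')))"
      using big
    proof
      assume "card V > real m / 4"
      from round[OF less.prems(1-3) this large(1) stuck] show ?thesis by metis
    next
      assume U: "card U > real m / 4"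
      have "(Z, X, V, U) \<in> reachable k" using less.prems(1) by (rule states_swap)
      moreover have "sw.admissible (Z, X, V, U)" "sw.saturated (Z, X, V, U)"
        using less.prems adm_sw sat_sw by blast+
      ultimately obtain Z' X' V' U' k' where "(Z', X', V', U') \<in> reachable k'"
        "sw.admissible (Z', X', V', U')" "sw.saturated (Z', X', V', U')"
        "real k' \<le> real k + s + 1 + (real (card (Z' + X')) - real (card (Z + X))) / \<tau>"
        "\<epsilon>\<^sup>2 * m / 16 \<le> (real (card V) + real (card U) - real (card (Z + X))) -
          (real (card V') + real (card U') - real (card (Z' + X')))"
        using sw.round[OF _ _ _ U large(2) stuck_sw] by metis
      then show ?thesis
        by (intro exI[of _ X'] exI[of _ Z'] exI[of _ U'] exI[of _ V'] exI[of _ k'])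
          (auto simp: adm_sw sat_sw add.commute intro: states_swap)
    qed
    then obtain X' Z' U' V' k' where new: "(X', Z', U', V') \<in> reachable k'"
      "admissible (X', Z', U', V')" "saturated (X', Z', U', V')"
      and cost: "real k' \<le> real k + s + 1 + (real (card (X' + Z')) - real (card (X + Z))) / \<tau>"
      and gain: "\<epsilon>\<^sup>2 * m / 16 \<le> (real (card U) + real (card V) - real (card (X + Z))) -
        (real (card U') + real (card V') - real (card (X' + Z')))"
      by blast
    have XZ': "card (X' + Z') \<le> card (A + B)"
      using new by (auto simp: admissible_def intro: card_sum_le)
    have pos: "\<epsilon>\<^sup>2 * m / 16 > 0" using eps m by simp
    have "container_within L"
    proof (rule less.hyps[OF _ new])
      show "card U' + card V' + card (A + B) - card (X' + Z') < card U + card V + card (A + B) - card (X + Z)"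
        using gain pos XZ XZ' by linarith
      \<comment> \<open>The price of potential in letters: a drop of
        \<open>\<epsilon>\<^sup>2 * m / 16\<close> pays for the \<open>s + 1\<close> letters of a
        round.\<close>
      define c where "c = (s + 1) * (16 / (\<epsilon>\<^sup>2 * m))"
      have "c \<ge> 0" by (simp add: c_def)
      have "real s + 1 = c * (\<epsilon>\<^sup>2 * m / 16)" using eps m by (simp add: c_def field_simps)
      also have "\<dots> \<le> c * ((real (card U) + real (card V) - real (card (X + Z))) -
        (real (card U') + real (card V') - real (card (X' + Z'))))"
        using gain \<open>c \<ge> 0\<close> by (intro mult_left_mono)
      finally have "real k' + c * (real (card U') + real (card V') + real (card (A + B)) - real (card (X' + Z'))) +
          (real (card (A + B)) - real (card (X' + Z'))) / \<tau> + s + 1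
        \<le> real k + c * (real (card U) + real (card V) + real (card (A + B)) - real (card (X + Z))) +
          (real (card (A + B)) - real (card (X + Z))) / \<tau> + s + 1"
        using cost by (simp add: algebra_simps diff_divide_distrib)
      also have "\<dots> \<le> real L" using less.prems(4) by (simp add: c_def)
      finally show "real k' + (s + 1) * (16 / (\<epsilon>\<^sup>2 * m)) * (real (card U') + real (card V') + real (card (A + B)) - real (card (X' + Z')))
      + (real (card (A + B)) - real (card (X' + Z'))) / \<tau> + s + 1 \<le> real L" by (simp add: c_def)
    qed
    with not show False by blast
  qed
qed

lemma (in sumset_pair) container_exists:
  fixes q :: real
  assumes q: "q = sqrt m" "17 \<le> q" and sq: "q / 4 \<le> s" "s \<le> q / 2"
    and AB: "q \<le> card A" "(1 + 1 / \<epsilon>\<^sup>2) * q \<le> card B"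
    and L: "63 * (1 / \<epsilon>\<^sup>2) * q \<le> real L"
  shows "container_within L"
proof -
  define E where "E = 1 / \<epsilon>\<^sup>2"
  have "\<epsilon>\<^sup>2 < 1 / 16"
    using power_strict_mono[OF eps(2), of 2] eps by (simp add: power2_eq_square)
  then have E: "16 \<le> E" "\<epsilon>\<^sup>2 * E = 1" using eps by (auto simp: E_def field_simps)
  have m: "real m = q * q" "m > 0" using q by (auto intro: Nat.gr0I)
  have theta_inv: "1 / \<theta> = 2 * E" by (simp add: \<theta>_def E_def)
  have "m / \<tau> = 4 * E * (q * q / s)" using m by (simp add: \<tau>_def E_def)
  also have "\<dots> \<le> 4 * E * (4 * q)"
    using E sq q s mult_left_mono[of "q" "4 * s" q] by (intro mult_left_mono) (auto simp: field_simps)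
  finally have m_tau: "m / \<tau> \<le> 16 * (E * q)" by simp
  have qE: "16 * q \<le> E * q" using E q by (intro mult_right_mono) auto
  have Es: "E * s \<le> E * q / 2" using mult_left_mono[OF sq(2), of E] E by simp
  have sum_tau: "(real (card (X + Z)) - real (card ({} + {} :: 'a set))) / \<tau> \<le> 16 * (E * q)"
    if "admissible (X, Z, U, V)" for X Z U V
  proof -
    have "card (X + Z) \<le> m"
      using that card_sum card_sum_le[of X Z] by (auto simp: admissible_def)
    then have "(real (card (X + Z)) - real (card ({} + {} :: 'a set))) / \<tau> \<le> m / \<tau>"
      using tau_pos by (intro divide_right_mono) auto
    then show ?thesis using m_tau by linarith
  qed
  have init: "({}, {}, Y, Y) \<in> reachable 0" "admissible ({}, {}, Y, Y)"
    using AY BY by (auto simp: admissible_def)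
  show ?thesis
  proof (cases "s + \<tau> \<le> \<theta> * card A")
    case False
    \<comment> \<open>Here \<open>A\<close> is too small for \<open>round\<close> but also cheap
      enough to be read completely; then nothing is left to list and \<open>finish\<close> applies
      with the empty set.\<close>
    obtain X Z U V k where new: "(X, Z, U, V) \<in> reachable k"
      "admissible (X, Z, U, V)" "saturated (X, Z, U, V)" "{} \<union> A \<subseteq> X"
      and k: "real k \<le> real 0 + real (card A) + real (card ({} :: 'a set)) + 1 +
        (real (card (X + Z)) - real (card ({} + {} :: 'a set))) / \<tau>"
      by (rule saturate_state[OF init subset_refl empty_subsetI])
    have "card A < (s + \<tau>) * (1 / \<theta>)" using False theta_pos by (simp add: field_simps)
    also have "\<dots> = 2 * (E * s) + s / 2"
      using theta_inv theta_pos unfolding tau_theta by (simp add: field_simps)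
    finally have "k \<le> 2 * (E * s) + s / 2 + 1 + 16 * (E * q)"
      using k sum_tau[OF new(2)] by simp
    then have "real (k + card ({} :: 'a set) + 1) \<le> 63 * (E * q)"
      using Es sq q qE by simp
    then have "k + card ({} :: 'a set) + 1 \<le> L"
      using L unfolding E_def[symmetric] by (simp only: mult.assoc flip: of_nat_le_iff)
    moreover have "\<theta> * s \<le> \<theta> * card A" using s theta_pos by simp
    then have "card ({} :: 'a set) + \<tau> < \<theta> * card A"
      using tau_theta tau_pos by simp
    then have "container_within (k + card ({} :: 'a set) + 1)"
      using new(4) by (intro finish[OF new(1-3)]) auto
    ultimately show ?thesis using container_within_mono by blast
  next
    case True
    \<comment> \<open>Here the lower bound on \<open>card B\<close> guarantees that rounds are
      possible on the other side as well.\<close>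
    have "s + \<tau> \<le> q / 2 + \<epsilon>\<^sup>2 * q / 2"
      using sq mult_left_mono[of s "q" "\<epsilon>\<^sup>2"] q eps unfolding \<tau>_def by (intro add_mono) auto
    also have "\<dots> = \<theta> * ((1 + E) * q)" using E by (simp add: \<theta>_def algebra_simps)
    also have "\<dots> \<le> \<theta> * card B" using AB theta_pos by (simp add: E_def)
    finally have largeB: "s + \<tau> \<le> \<theta> * card B" .
    obtain F G where F: "F \<subseteq> A" "card F = s" and G: "G \<subseteq> B" "card G = s"
      using s by (metis obtain_subset_with_card_n)
    obtain X Z U V k where new: "(X, Z, U, V) \<in> reachable k"
      "admissible (X, Z, U, V)" "saturated (X, Z, U, V)" "{} \<union> F \<subseteq> X" "{} \<union> G \<subseteq> Z"
      and k: "real k \<le> real 0 + real (card F) + real (card G) + 1 +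
        (real (card (X + Z)) - real (card ({} + {} :: 'a set))) / \<tau>"
      by (rule saturate_state[OF init F(1) G(1)])
    have sub: "X \<subseteq> A" "Z \<subseteq> B" "U \<subseteq> Y" "V \<subseteq> Y" using new by (auto simp: admissible_def)
    have fins: "finite X" "finite Z" "finite U" "finite V" "finite (X + Z)"
      using sub fin finY by (auto intro: finite_subset finite_set_plus)
    have XZ: "card (X + Z) \<le> card (A + B)" using sub by (intro card_sum_le)
    \<comment> \<open>Double counting: an element of \<open>T\<close> has at most \<open>m\<close>
      sums with \<open>W\<close> inside \<open>X + Z\<close>, an element of \<open>W\<close> has
      fewer than \<tau> sums with \<open>T\<close> outside it, and \<tau> is small against
      \<open>s \<le> card T\<close>. For this, \<open>s\<close> elements of each side are read
      first.\<close>
    have size: "real (card W) \<le> 3 / 2 * m"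
      if "finite W" "finite T" "s \<le> card T" "\<And>b. b \<in> W \<Longrightarrow> real (deg (X + Z) T b) < \<tau>" for W T
    proof -
      have "real (card T * card W) \<le> real (card T * card (X + Z) + off (X + Z) T W)"
        using card_times_le_off[OF that(2,1) fins(5)] of_nat_le_iff by blast
      also have "\<dots> \<le> card T * real m + \<tau> * card W"
        using that XZ card_sum
        by (auto intro!: add_mono mult_left_mono off_le_of_deg_le simp: less_imp_le)
      also have "\<tau> * card W \<le> card T * real (card W) / 3"
      proof -
        have "\<epsilon>\<^sup>2 * s \<le> 1 / 16 * card T"
          using \<open>\<epsilon>\<^sup>2 < 1 / 16\<close> that by (intro mult_mono) auto
        then have "\<tau> \<le> card T / 3" unfolding \<tau>_def by linarith
        from mult_right_mono[OF this, of "card W"] show ?thesis by simp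
      qed
      finally have "card T * real (card W) \<le> card T * (3 / 2 * m)" by simp
      then show ?thesis using that s by simp
    qed
    have "s \<le> card X" "s \<le> card Z"
      using new(4,5) fins card_mono[of X F] card_mono[of Z G] F(2) G(2) by auto
    then have UV: "real (card U) \<le> 3 / 2 * m" "real (card V) \<le> 3 / 2 * m"
      using size[OF fins(3,2)] size[OF fins(4,1)] new(3) unfolding saturated_def by blast+
    show ?thesis
    proof (rule container_by_rounds[OF new(1-3) True largeB m(2)])
      \<comment> \<open>The potential is at most \<open>4 * m\<close>, hence at most
        \<open>64 * E\<close> rounds, and \<open>s + 1 \<le> 9 / 16 * q\<close> since
        \<open>17 \<le> q\<close>.\<close>
      have "(s + 1) * (16 / (\<epsilon>\<^sup>2 * m)) * (real (card U) + real (card V) + real (card (A + B)) - real (card (X + Z)))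
          \<le> (s + 1) * (16 / (\<epsilon>\<^sup>2 * m)) * (4 * m)"
        using UV card_sum by (intro mult_left_mono) auto
      also have "\<dots> = 64 * E * (s + 1)" using m(2) eps by (simp add: E_def)
      also have "\<dots> \<le> 64 * E * (9 / 16 * q)"
        using E q sq by (intro mult_left_mono) auto
      also have "\<dots> = 36 * (E * q)" by simp
      finally have 1: "(s + 1) * (16 / (\<epsilon>\<^sup>2 * m)) * (real (card U) + real (card V) + real (card (A + B)) - real (card (X + Z)))
          \<le> 36 * (E * q)" .
      have "real k + (real (card (A + B)) - real (card (X + Z))) / \<tau> \<le> 2 * s + 1 + card (A + B) / \<tau>"
        using k F G by (simp add: diff_divide_distrib)
      also have "card (A + B) / \<tau> \<le> m / \<tau>"
        using card_sum tau_pos by (intro divide_right_mono) auto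
      finally have "real k + (real (card (A + B)) - real (card (X + Z))) / \<tau> \<le> 2 * s + 1 + 16 * (E * q)"
        using m_tau by linarith
      with 1 show "real k + (s + 1) * (16 / (\<epsilon>\<^sup>2 * m)) * (real (card U) + real (card V) + real (card (A + B)) - real (card (X + Z)))
        + (real (card (A + B)) - real (card (X + Z))) / \<tau> + s + 1 \<le> real L"
        using L[folded E_def] qE sq q by simp
    qed
  qed
qed

section \<open>The family of containers\<close>

lemma card_sum_hyperedges:
  assumes "U \<subseteq> Y" "V \<subseteq> Y"
  shows "card (sum_hyperedges ((Y + Y) - D) U V) = off D U V"
proof -
  have "bij_betw snd (sum_hyperedges ((Y + Y) - D) U V) {p \<in> U \<times> V. fst p + snd p \<notin> D}"
    by (rule bij_betw_byWitness[where f' = "\<lambda>p. (fst p + snd p, p)"])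
      (use assms in \<open>auto simp: sum_hyperedges_def intro!: set_plus_intro\<close>)
  then show ?thesis unfolding off_def by (rule bij_betw_same_card)
qed

lemma card_le_card_sum:
  fixes A B :: "'a::ab_group_add set"
  assumes "finite A" "finite B" "A \<noteq> {}"
  shows "card B \<le> card (A + B)"
proof -
  obtain a where "a \<in> A" using assms by auto
  then show ?thesis
    using assms by (intro card_inj_on_le[of "(+) a"] finite_set_plus) (auto intro: set_plus_intro)
qed

theorem theorem1p8:
  fixes n m :: nat and \<epsilon> :: real and Y :: "'a::ab_group_add set" and \<beta> :: nat
  assumes "n > 0" and "m > 0"
    and "0 < \<epsilon>" and "\<epsilon> < 1 / 4"
    and "finite Y" and "card Y = n"
    and "\<beta> = beta TYPE('a) ((1 + 4 * \<epsilon>) * real m)"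
  shows "\<exists>\<C> \<subseteq> Pow (Y + Y) \<times> Pow Y \<times> Pow Y.
    real (card \<C>) \<le> real n powr (2 ^ 7 * (1 / \<epsilon>\<^sup>2) * sqrt (real m)) \<and>
    (\<forall>A B. A \<subseteq> Y \<longrightarrow> B \<subseteq> Y \<longrightarrow>
       real (card A) \<ge> sqrt (real m) \<longrightarrow>
       real (card B) \<ge> (1 + 1 / \<epsilon>\<^sup>2) * sqrt (real m) \<longrightarrow>
       card (A + B) \<le> m \<longrightarrow>
       (\<exists>(C0, C1, C2) \<in> \<C>.
          (Y + Y) - (A + B) \<subseteq> C0 \<and> A \<subseteq> C1 \<and> B \<subseteq> C2 \<and>
          real (card C1) + real (card C2) \<le> (1 + 2 * \<epsilon>) * (real m + real \<beta>))) \<and>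
    (\<forall>(C0, C1, C2) \<in> \<C>.
       (real (card C1) \<le> real m / 4 \<and> real (card C2) \<le> real m / 4) \<or>
       real (card (sum_hyperedges C0 C1 C2)) < \<epsilon>\<^sup>2 * real (card C1) * real (card C2))"
proof -
  define q where "q = sqrt m"
  define E where "E = 1 / \<epsilon>\<^sup>2"
  define good where "good = (\<lambda>(C0 :: 'a set, C1, C2). (real (card C1) \<le> real m / 4 \<and> real (card C2) \<le> real m / 4) \<or>
       real (card (sum_hyperedges C0 C1 C2)) < \<epsilon>\<^sup>2 * real (card C1) * real (card C2))"
  define pair where "pair = (\<lambda>A B :: 'a set. A \<subseteq> Y \<and> B \<subseteq> Y \<and> real (card A) \<ge> q \<and>
    real (card B) \<ge> (1 + E) * q \<and> card (A + B) \<le> m)"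
  have "\<epsilon>\<^sup>2 < 1 / 16"
    using power_strict_mono[OF assms(4), of 2] assms(3) by (simp add: power2_eq_square)
  then have E: "16 \<le> E" using assms(3) by (simp add: E_def field_simps)
  have q1: "q \<ge> 1" "real m = q * q" using \<open>m > 0\<close> by (auto simp: q_def)
  \<comment> \<open>A translate of \<open>B\<close> lies in \<open>A + B\<close>, so
    \<open>17 * q \<le> card B \<le> m = q * q\<close>: a single pair to cover forces
    \<open>q\<close> and \<open>n\<close> to be large.\<close>
  have pair_facts: "17 \<le> q" "4 \<le> n" "3 / \<epsilon> \<le> card B" if "pair A B" for A B
  proof -
    have f: "finite A" "finite B" using that \<open>finite Y\<close> by (auto simp: pair_def intro: finite_subset)
    have A: "card A > 0" using that q1 by (auto simp: pair_def intro: Nat.gr0I)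
    have "17 * q \<le> (1 + E) * q" using E q1 by (intro mult_right_mono) auto
    also have "\<dots> \<le> card B" using that by (simp add: pair_def)
    finally have B: "17 * q \<le> card B" .
    also have "\<dots> \<le> q * q"
      using card_le_card_sum[of A B] f A that unfolding q1(2)[symmetric] by (fastforce simp: pair_def)
    finally show "17 \<le> q" using q1 by simp
    have "card B \<le> n" using that \<open>finite Y\<close> \<open>card Y = n\<close> by (auto simp: pair_def intro: card_mono)
    then show "4 \<le> n" using B q1 by linarith
    have "3 / \<epsilon> \<le> E" using assms(3,4) by (simp add: E_def field_simps power2_eq_square)
    also have "\<dots> \<le> (1 + E) * 1" by simp
    also have "\<dots> \<le> (1 + E) * q" using E q1 by (intro mult_left_mono) auto
    also have "\<dots> \<le> card B" using that by (simp add: pair_def)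
    finally show "3 / \<epsilon> \<le> card B" .
  qed
  show ?thesis
  \<comment> \<open>With no pair to cover, the empty family suffices; this disposes of values of
    \<open>n\<close> and \<open>m\<close> too small for the estimates.\<close>
  proof (cases "\<exists>A B. pair A B")
    case False
    then show ?thesis by (intro exI[of _ "{}"]) (auto simp: pair_def q_def E_def)
  next
    case True
    then have q: "17 \<le> q" and n: "4 \<le> n" using pair_facts by blast+
    \<comment> \<open>With \<open>s\<close> of order \<open>q\<close>, the rounds (about
      \<open>E * s\<close> letters) and the saturations (\<open>m / \<tau>\<close>, about
      \<open>E * m / s\<close> letters) both cost a multiple of \<open>E * q\<close>.\<close>
    define s where "s = nat \<lceil>q / 4\<rceil>"
    have s_bounds: "q / 4 \<le> s" "s \<le> q / 2" "s > 0" using q by (auto simp: s_def) linarith+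
    define L where "L = nat \<lfloor>64 * E * q\<rfloor>"
    have Eq: "1 \<le> E * q" using mult_mono[of 1 E 1 q] E q by simp
    then have L: "63 * E * q \<le> L" "L \<le> 64 * E * q" by (auto simp: L_def) linarith+
    define S where "S = states (\<epsilon>\<^sup>2 * s / 4) (\<epsilon>\<^sup>2 / 2) Y L"
    define cont where "cont = (\<lambda>(X :: 'a set, Z, U :: 'a set, V :: 'a set). ((Y + Y) - (X + Z), U, V))"
    \<comment> \<open>Arbitrary words may lead to useless states; filtering them out makes the
      additional property hold by construction.\<close>
    define \<C> where "\<C> = {c \<in> cont ` S. c \<in> Pow (Y + Y) \<times> Pow Y \<times> Pow Y \<and> good c}"
    have "card \<C> \<le> card (cont ` S)"
      unfolding \<C>_def S_def using \<open>finite Y\<close> by (intro card_mono) (auto simp: finite_states)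
    also have "\<dots> \<le> card S" unfolding S_def using \<open>finite Y\<close> by (intro card_image_le finite_states)
    also have "\<dots> \<le> (2 * n + 4) ^ L"
      unfolding S_def using card_states_le[OF \<open>finite Y\<close>] \<open>card Y = n\<close> by blast
    \<comment> \<open>Two factors \<open>n\<close> per letter turn the word length
      \<open>64 * E * q\<close> into the exponent \<open>2 ^ 7 * E * q\<close>.\<close>
    also have "2 * n + 4 \<le> n * n" using mult_le_mono1[OF n, of n] n by linarith
    then have "(2 * n + 4) ^ L \<le> (n * n) ^ L" by (intro power_mono) auto
    finally have "real (card \<C>) \<le> real ((n * n) ^ L)" by (rule of_nat_mono)
    also have "\<dots> = real n powr (2 * L)"
      using \<open>n > 0\<close> by (simp add: powr_realpow[symmetric] power_mult_distrib powr_add[symmetric])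
    also have "\<dots> \<le> real n powr (2 ^ 7 * E * q)"
      using L(2) n by (intro powr_mono) auto
    finally have card: "real (card \<C>) \<le> real n powr (2 ^ 7 * E * q)" .
    have cover: "\<exists>(C0, C1, C2) \<in> \<C>. (Y + Y) - (A + B) \<subseteq> C0 \<and> A \<subseteq> C1 \<and> B \<subseteq> C2 \<and>
          real (card C1) + real (card C2) \<le> (1 + 2 * \<epsilon>) * (real m + real \<beta>)"
      if AB: "pair A B" for A B
    proof -
      have AB': "A \<subseteq> Y" "B \<subseteq> Y" "q \<le> card A" "(1 + E) * q \<le> card B" "card (A + B) \<le> m"
        using AB by (auto simp: pair_def)
      have "q \<le> (1 + E) * q" using E q by simp
      then have "s \<le> card A" "s \<le> card B" using s_bounds(2) AB' q by linarith+
      then interpret sumset_pair Y A B m s \<epsilon>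
        using AB' assms s_bounds by unfold_locales auto
      have "container_within L"
        using AB' q s_bounds L unfolding E_def by (intro container_exists[OF q_def])
      then obtain X Z U V where XZUV: "(X, Z, U, V) \<in> S" "admissible (X, Z, U, V)"
        and dense: "(real (card U) \<le> real m / 4 \<and> real (card V) \<le> real m / 4) \<or>
          real (off (X + Z) U V) < \<epsilon>\<^sup>2 * real (card U) * real (card V)"
        unfolding container_within_def S_def \<tau>_def \<theta>_def by blast
      have sub: "X \<subseteq> A" "Z \<subseteq> B" "A \<subseteq> U" "U \<subseteq> Y" "B \<subseteq> V" "V \<subseteq> Y"
        using XZUV(2) by (auto simp: admissible_def)
      have fins: "finite U" "finite V" "finite (X + Z)"
        using sub fin \<open>finite Y\<close> by (auto intro: finite_subset finite_set_plus)
      have "cont (X, Z, U, V) \<in> \<C>"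
        using XZUV dense sub unfolding \<C>_def good_def cont_def
        by (auto simp: card_sum_hyperedges[OF sub(4,6)] image_iff intro!: bexI[of _ "(X, Z, U, V)"])
      moreover have "X + Z \<subseteq> A + B" using sub by (intro set_plus_mono2)
      moreover have "real (card U) + real (card V) \<le> (1 + 2 * \<epsilon>) * (real m + real \<beta>)"
        using dense
      proof
        assume "real (card U) \<le> real m / 4 \<and> real (card V) \<le> real m / 4"
        then have "real (card U) + real (card V) \<le> real m" by simp
        also have "\<dots> \<le> (1 + 2 * \<epsilon>) * (real m + real \<beta>)"
          using \<open>0 < \<epsilon>\<close> by (simp add: algebra_simps)
        finally show ?thesis .
      next
        assume few: "real (off (X + Z) U V) < \<epsilon>\<^sup>2 * real (card U) * real (card V)"
        have "card B \<le> card V" using sub fins by (intro card_mono)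
        then have "3 / \<epsilon> \<le> real (card U) + real (card V)" using pair_facts(3)[OF AB] by linarith
        moreover have "card (X + Z) \<le> m" using card_sum_le[OF sub(1,2)] AB' by linarith
        ultimately show ?thesis
          using few fins \<open>0 < \<epsilon>\<close> \<open>\<epsilon> < 1 / 4\<close> unfolding \<open>\<beta> = _\<close>
          by (intro card_add_card_le_of_few_off[of \<epsilon> m _ U V "X + Z"] card_le_beta)
      qed
      ultimately show ?thesis
        using sub by (intro bexI[of _ "cont (X, Z, U, V)"]) (auto simp: cont_def)
    qed
    have "\<C> \<subseteq> Pow (Y + Y) \<times> Pow Y \<times> Pow Y" by (auto simp: \<C>_def)
    moreover have "\<forall>c\<in>\<C>. good c" by (auto simp: \<C>_def)
    ultimately show ?thesis
      using card cover unfolding pair_def q_def E_def good_def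
      by (intro exI[of _ \<C>] conjI allI impI) simp_all
  qed
qed

end
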